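(* Let $\lambda_0\in\mathbb{N}$, and for every $\nu\in\mathbb{N}\setminus\{0\}$ let $\ell^+(\hat\lambda,\nu)=\mathcal{L}^+(\hat\lambda,\nu)/\hat\lambda$ be the relative loss function of the additive restart strategy $\lambda_k=\lambda_0+k\nu$. Then $\ell^+(\hat\lambda,\nu)$ is strictly unbounded for all $\nu\in\mathbb{N}\setminus\{0\}$.
   Context: A restart strategy is an unbounded sequence $(\lambda_0,\lambda_1,\lambda_2,\ldots)$ of natural numbers. The additive strategy with start value $\lambda_0$ and restart parameter $\nu\in\mathbb{N}\setminus\{0\}$ has $\lambda_k=\lambda_0+k\nu$ for $k\ge 0$. For an integer $\hat\lambda\ge\lambda_0$ let $\hat k(\hat\lambda)=\min\{k\ge 0 : \lambda_k\ge\hat\lambda\}$. The loss function is $\mathcal{L}^+(\hat\lambda,\nu)=\sum_{k=0}^{\hat k(\hat\lambda)}\lambda_k-\hat\lambda$. The relative loss is $\ell^+(\hat\lambda,\nu)=\mathcal{L}^+(\hat\lambda,\nu)/\hat\lambda$ (for integers $\hat\lambda\ge\lambda_0$, $\hat\lambda\geq 1$). For a fixed restart parameter, an asymptotic lower bound is the limit as $\hat\lambda\to\infty$ of a function $\ell_{\mathrm{low}}(\hat\lambda,\nu)$ which is a lower bound of the relative loss function for all admissible $\hat\lambda$; the strategy (or its relative loss) is called strictly unbounded if there exists an infinite ($+\infty$) asymptotic lower bound. *)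

theory Defs
  imports Complex_Main "HOL-Library.Extended_Real"
begin

definition restart_strategy :: "(nat \<Rightarrow> nat) \<Rightarrow> bool" where
  "restart_strategy s \<longleftrightarrow> \<not> bdd_above (range s)"

definition additive_strategy :: "nat \<Rightarrow> nat \<Rightarrow> nat \<Rightarrow> nat" where
  "additive_strategy s0 \<nu> k = s0 + k * \<nu>"

definition hit_index :: "(nat \<Rightarrow> nat) \<Rightarrow> nat \<Rightarrow> nat" where
  "hit_index s m = (LEAST k. m \<le> s k)"

definition loss :: "(nat \<Rightarrow> nat) \<Rightarrow> nat \<Rightarrow> int" where
  "loss s m = (\<Sum>k = 0..hit_index s m. int (s k)) - int m"

definition relative_loss :: "(nat \<Rightarrow> nat) \<Rightarrow> nat \<Rightarrow> real" where
  "relative_loss s m = real_of_int (loss s m) / real m"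

definition admissible :: "(nat \<Rightarrow> nat) \<Rightarrow> nat set" where
  "admissible s = {m. s 0 \<le> m \<and> 1 \<le> m}"

text \<open>The bounding function is real-valued and is compared with f only on D, while its limit
  may be infinite and is therefore taken in the extended reals. For the sets D used here, all
  sufficiently large numbers lie in D, so values outside D do not affect the limit.\<close>

definition asymptotic_lower_bound :: "nat set \<Rightarrow> (nat \<Rightarrow> real) \<Rightarrow> ereal \<Rightarrow> bool" where
  "asymptotic_lower_bound D f b \<longleftrightarrow>
     (\<exists>low :: nat \<Rightarrow> real. (\<forall>m\<in>D. low m \<le> f m) \<and> (\<lambda>m. ereal (low m)) \<longlonglongrightarrow> b)"

definition strictly_unbounded :: "nat set \<Rightarrow> (nat \<Rightarrow> real) \<Rightarrow> bool" where
  "strictly_unbounded D f \<longleftrightarrow> asymptotic_lower_bound D f \<infinity>"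

text \<open>Unboundedness makes the minimum in \<^const>\<open>hit_index\<close> exist.\<close>

lemma hit_index_reaches:
  assumes "restart_strategy s"
  shows "m \<le> s (hit_index s m)"
proof -
  have "\<exists>k. m \<le> s k"
    using assms unfolding restart_strategy_def by (meson bdd_aboveI2 nat_le_linear)
  then show ?thesis
    unfolding hit_index_def by (rule LeastI_ex)
qed

lemma restart_strategy_additive:
  assumes "\<nu> \<noteq> 0"
  shows "restart_strategy (additive_strategy s0 \<nu>)"
  unfolding restart_strategy_def
proof
  assume "bdd_above (range (additive_strategy s0 \<nu>))"
  then obtain B where B: "\<And>k. s0 + k * \<nu> \<le> B"
    by (auto simp: bdd_above_def additive_strategy_def)
  have "Suc B * 1 \<le> Suc B * \<nu>"
    using assms by (intro mult_le_mono) auto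
  with B[of "Suc B"] have "Suc B \<le> B"
    by (metis add_leE le_trans mult.right_neutral)
  then show False by simp
qed

end

theory Submission
  imports Defs "HOL-Real_Asymp.Real_Asymp"
begin

text \<open>Reaching \<open>m\<close> takes at least \<open>(m - s0) / \<nu>\<close> restarts, so the accumulated cost grows
  quadratically in \<open>m\<close> and the relative loss is at least \<open>(m - s0)\<^sup>2 / (2 \<nu> m) - 1\<close>, which
  tends to infinity linearly.\<close>

text \<open>The exact sum is \<open>s0 * (n + 1) + \<nu> * n * (n + 1) / 2\<close>; keeping only its
  quadratic term leaves a form that a squared lower bound on \<open>\<nu> * n\<close> can be
  compared with directly.\<close>

lemma sum_additive_strategy_ge:
  "real \<nu> * (real n)\<^sup>2 / 2 \<le> (\<Sum>k = 0..n. real (additive_strategy s0 \<nu> k))"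
proof (induction n)
  case 0
  show ?case by simp
next
  case (Suc n)
  have "real \<nu> * (real (Suc n))\<^sup>2 / 2
      \<le> real \<nu> * (real n)\<^sup>2 / 2 + real (additive_strategy s0 \<nu> (Suc n))"
    by (simp add: additive_strategy_def power2_eq_square field_simps)
  with Suc show ?case by simp
qed

lemma relative_loss_additive_ge:
  assumes "\<nu> \<noteq> 0" "s0 \<le> m" "1 \<le> m"
  shows "(real m - real s0)\<^sup>2 / (2 * real \<nu> * real m) - 1
    \<le> relative_loss (additive_strategy s0 \<nu>) m"
proof -
  let ?s = "additive_strategy s0 \<nu>"
  define k where "k = hit_index ?s m"
  have "m \<le> s0 + k * \<nu>"
    using hit_index_reaches[OF restart_strategy_additive[OF assms(1)], of m s0]
    by (simp add: k_def additive_strategy_def)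
  then have "real m \<le> real (s0 + k * \<nu>)"
    by (rule of_nat_mono)
  then have "real m - real s0 \<le> real \<nu> * real k"
    by (simp add: mult.commute)
  \<comment> \<open>Squaring preserves the inequality because \<open>s0 \<le> m\<close> makes the
    left side nonnegative.\<close>
  then have "(real m - real s0)\<^sup>2 \<le> (real \<nu> * real k)\<^sup>2"
    using assms(2) by (intro power_mono) auto
  then have "(real m - real s0)\<^sup>2 / (2 * real \<nu>) \<le> real \<nu> * (real k)\<^sup>2 / 2"
    using assms(1) by (simp add: field_simps power2_eq_square)
  also have "\<dots> \<le> (\<Sum>i = 0..k. real (?s i))"
    by (rule sum_additive_strategy_ge)
  finally have "(real m - real s0)\<^sup>2 / (2 * real \<nu>) - real m \<le> real_of_int (loss ?s m)"
    by (simp add: loss_def k_def)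
  then have "((real m - real s0)\<^sup>2 / (2 * real \<nu>) - real m) / real m \<le> relative_loss ?s m"
    unfolding relative_loss_def by (rule divide_right_mono) simp
  then show ?thesis
    \<comment> \<open>The subtracted \<open>m\<close> becomes exactly 1 after division since
      \<open>m\<close> is positive; at \<open>m = 0\<close> the quotient would be 0.\<close>
    using assms(3) by (simp add: diff_divide_distrib)
qed

theorem theorem9:
  fixes s0 :: nat
  shows "\<forall>\<nu>::nat. \<nu> \<noteq> 0 \<longrightarrow>
    strictly_unbounded (admissible (additive_strategy s0 \<nu>))
      (relative_loss (additive_strategy s0 \<nu>))"
proof (intro allI impI)
  fix \<nu> :: nat
  assume "\<nu> \<noteq> 0"
  let ?low = "\<lambda>m. (real m - real s0)\<^sup>2 / (2 * real \<nu> * real m) - 1"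
  \<comment> \<open>The leading term of \<open>?low\<close> is \<open>m / (2 * \<nu>)\<close>, so
    the sign of \<open>\<nu>\<close> decides that the limit is plus infinity.\<close>
  have "real \<nu> > 0"
    using \<open>\<nu> \<noteq> 0\<close> by simp
  then have "filterlim ?low at_top sequentially"
    by real_asymp
  then have "(\<lambda>m. ereal (?low m)) \<longlonglongrightarrow> \<infinity>"
    by (simp add: tendsto_PInfty_eq_at_top)
  moreover have "\<forall>m\<in>admissible (additive_strategy s0 \<nu>).
      ?low m \<le> relative_loss (additive_strategy s0 \<nu>) m"
    using relative_loss_additive_ge[OF \<open>\<nu> \<noteq> 0\<close>]
    by (auto simp: admissible_def additive_strategy_def)
  ultimately show "strictly_unbounded (admissible (additive_strategy s0 \<nu>))
      (relative_loss (additive_strategy s0 \<nu>))"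
    unfolding strictly_unbounded_def asymptotic_lower_bound_def by (intro exI[of _ ?low] conjI)
qed

end
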